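(* Let $\mathcal{C}$ be a precoherent category. The coherent topology on $\mathcal{C}$ is subcanonical, i.e. for every object $W$ of $\mathcal{C}$ the representable presheaf $\operatorname{Hom}_{\mathcal{C}}(-,W)$ is a sheaf for the coherent topology.
   Context: A family of morphisms $(f_i\colon X_i\to B)_{i\in I}$ is effective epimorphic if for every object $W$ and every family $(e_i\colon X_i\to W)_{i\in I}$ such that $e_i\circ g_i=e_j\circ g_j$ whenever $i,j\in I$, $g_i\colon Z\to X_i$, $g_j\colon Z\to X_j$ satisfy $f_i\circ g_i=f_j\circ g_j$, there is a unique $d\colon B\to W$ with $d\circ f_i=e_i$ for all $i$. A category is precoherent if for every finite effective epimorphic family $(\pi_i\colon X_i\to B)_{i\in I}$ and every morphism $f\colon B'\to B$ there is a finite effective epimorphic family $(\pi'_j\colon X'_j\to B')_{j\in J}$ such that each $f\circ\pi'_j$ factors through some $\pi_i$. The coherent topology on a precoherent category is the smallest Grothendieck topology in which the sieve generated by each finite effective epimorphic family is a covering sieve. *)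

theory Defs
  imports Main
begin

record ('o, 'm) cat =
  ob :: "'o set"
  arr :: "'m set"
  src :: "'m \<Rightarrow> 'o"
  tgt :: "'m \<Rightarrow> 'o"
  idm :: "'o \<Rightarrow> 'm"
  compose :: "'m \<Rightarrow> 'm \<Rightarrow> 'm"  (infixl "\<cdot>\<index>" 70)

definition hom :: "('o, 'm) cat \<Rightarrow> 'o \<Rightarrow> 'o \<Rightarrow> 'm set" where
  "hom C X Y = {f \<in> arr C. src C f = X \<and> tgt C f = Y}"

text \<open>Composition is in applicative order (\<open>g \<cdot>\<^bsub>C\<^esub> f\<close> is \<open>g\<close> after \<open>f\<close>) and is
  unspecified on non-composable pairs.\<close>

locale category =
  fixes C :: "('o, 'm) cat" (structure)
  assumes src_ob: "f \<in> arr C \<Longrightarrow> src C f \<in> ob C"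
    and tgt_ob: "f \<in> arr C \<Longrightarrow> tgt C f \<in> ob C"
    and idm_hom: "X \<in> ob C \<Longrightarrow> idm C X \<in> hom C X X"
    and compose_hom: "f \<in> hom C X Y \<Longrightarrow> g \<in> hom C Y Z \<Longrightarrow> g \<cdot> f \<in> hom C X Z"
    and compose_idm_right: "f \<in> hom C X Y \<Longrightarrow> f \<cdot> idm C X = f"
    and compose_idm_left: "f \<in> hom C X Y \<Longrightarrow> idm C Y \<cdot> f = f"
    and compose_assoc:
      "f \<in> hom C X Y \<Longrightarrow> g \<in> hom C Y Z \<Longrightarrow> h \<in> hom C Z V \<Longrightarrow> (h \<cdot> g) \<cdot> f = h \<cdot> (g \<cdot> f)"

text \<open>A family \<open>(f\<^sub>i : X\<^sub>i \<rightarrow> B)\<close> is given by its index set \<open>I\<close>, the arrows \<open>f i\<close>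
  and the common target \<open>B\<close>; the object \<open>X\<^sub>i\<close> is \<open>src C (f i)\<close>.  The target is a separate
  argument because \<open>I\<close> may be empty.\<close>

definition family_to :: "('o, 'm) cat \<Rightarrow> 'i set \<Rightarrow> ('i \<Rightarrow> 'm) \<Rightarrow> 'o \<Rightarrow> bool" where
  "family_to C I f B \<longleftrightarrow> B \<in> ob C \<and> (\<forall>i\<in>I. f i \<in> arr C \<and> tgt C (f i) = B)"

definition effective_epi_family :: "('o, 'm) cat \<Rightarrow> 'i set \<Rightarrow> ('i \<Rightarrow> 'm) \<Rightarrow> 'o \<Rightarrow> bool" where
  "effective_epi_family C I f B \<longleftrightarrow> family_to C I f B \<and>
    (\<forall>W\<in>ob C. \<forall>e.
      (\<forall>i\<in>I. e i \<in> hom C (src C (f i)) W) \<and>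
      (\<forall>i\<in>I. \<forall>j\<in>I. \<forall>Z\<in>ob C. \<forall>g\<in>hom C Z (src C (f i)). \<forall>h\<in>hom C Z (src C (f j)).
         f i \<cdot>\<^bsub>C\<^esub> g = f j \<cdot>\<^bsub>C\<^esub> h \<longrightarrow> e i \<cdot>\<^bsub>C\<^esub> g = e j \<cdot>\<^bsub>C\<^esub> h) \<longrightarrow>
      (\<exists>!d. d \<in> hom C B W \<and> (\<forall>i\<in>I. d \<cdot>\<^bsub>C\<^esub> f i = e i)))"

text \<open>Finite families are indexed by finite sets of natural numbers here and below; being
  effective epimorphic and the generated sieve are invariant under reindexing along a bijection,
  so this covers all finite index sets.  The empty family is included.\<close>

locale precoherent_category = category +
  assumes precoherent:
    "\<lbrakk> finite (I :: nat set); effective_epi_family C I p B; f \<in> hom C B' B \<rbrakk> \<Longrightarrow>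
      \<exists>(J :: nat set) p'. finite J \<and> effective_epi_family C J p' B' \<and>
        (\<forall>j\<in>J. \<exists>i\<in>I. \<exists>h\<in>hom C (src C (p' j)) (src C (p i)). f \<cdot> p' j = p i \<cdot> h)"

definition sieve_on :: "('o, 'm) cat \<Rightarrow> 'o \<Rightarrow> 'm set \<Rightarrow> bool" where
  "sieve_on C X S \<longleftrightarrow> S \<subseteq> {f \<in> arr C. tgt C f = X} \<and>
    (\<forall>f\<in>S. \<forall>Z\<in>ob C. \<forall>g\<in>hom C Z (src C f). f \<cdot>\<^bsub>C\<^esub> g \<in> S)"

definition maximal_sieve :: "('o, 'm) cat \<Rightarrow> 'o \<Rightarrow> 'm set" where
  "maximal_sieve C X = {f \<in> arr C. tgt C f = X}"

definition pullback_sieve :: "('o, 'm) cat \<Rightarrow> 'm \<Rightarrow> 'm set \<Rightarrow> 'm set" where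
  "pullback_sieve C f S = {g \<in> arr C. tgt C g = src C f \<and> f \<cdot>\<^bsub>C\<^esub> g \<in> S}"

definition generated_sieve :: "('o, 'm) cat \<Rightarrow> 'i set \<Rightarrow> ('i \<Rightarrow> 'm) \<Rightarrow> 'm set" where
  "generated_sieve C I f = {f i \<cdot>\<^bsub>C\<^esub> g | i g. i \<in> I \<and> g \<in> arr C \<and> tgt C g = src C (f i)}"

text \<open>\<open>J X\<close> is the set of covering sieves on \<open>X\<close>; its value outside \<open>ob C\<close> is irrelevant.\<close>

definition grothendieck_topology :: "('o, 'm) cat \<Rightarrow> ('o \<Rightarrow> 'm set set) \<Rightarrow> bool" where
  "grothendieck_topology C J \<longleftrightarrow>
    (\<forall>X\<in>ob C. \<forall>S\<in>J X. sieve_on C X S) \<and>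
    (\<forall>X\<in>ob C. maximal_sieve C X \<in> J X) \<and>
    (\<forall>X\<in>ob C. \<forall>S\<in>J X. \<forall>Y\<in>ob C. \<forall>f\<in>hom C Y X. pullback_sieve C f S \<in> J Y) \<and>
    (\<forall>X\<in>ob C. \<forall>S\<in>J X. \<forall>R. sieve_on C X R \<and>
       (\<forall>f\<in>S. pullback_sieve C f R \<in> J (src C f)) \<longrightarrow> R \<in> J X)"

definition contains_finite_effective_epis :: "('o, 'm) cat \<Rightarrow> ('o \<Rightarrow> 'm set set) \<Rightarrow> bool" where
  "contains_finite_effective_epis C J \<longleftrightarrow>
    (\<forall>(I :: nat set) f B. finite I \<and> effective_epi_family C I f B \<longrightarrow> generated_sieve C I f \<in> J B)"

definition coherent_topology :: "('o, 'm) cat \<Rightarrow> 'o \<Rightarrow> 'm set set" where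
  "coherent_topology C X =
    \<Inter> {J X | J. grothendieck_topology C J \<and> contains_finite_effective_epis C J}"

record ('o, 'm, 'a) psh =
  sections :: "'o \<Rightarrow> 'a set"
  restr :: "'m \<Rightarrow> 'a \<Rightarrow> 'a"

definition presheaf :: "('o, 'm) cat \<Rightarrow> ('o, 'm, 'a) psh \<Rightarrow> bool" where
  "presheaf C F \<longleftrightarrow>
    (\<forall>X\<in>ob C. \<forall>Y\<in>ob C. \<forall>f\<in>hom C X Y. \<forall>s\<in>sections F Y. restr F f s \<in> sections F X) \<and>
    (\<forall>X\<in>ob C. \<forall>s\<in>sections F X. restr F (idm C X) s = s) \<and>
    (\<forall>X\<in>ob C. \<forall>Y\<in>ob C. \<forall>Z\<in>ob C. \<forall>f\<in>hom C X Y. \<forall>g\<in>hom C Y Z. \<forall>s\<in>sections F Z.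
       restr F (g \<cdot>\<^bsub>C\<^esub> f) s = restr F f (restr F g s))"

definition matching_family ::
    "('o, 'm) cat \<Rightarrow> ('o, 'm, 'a) psh \<Rightarrow> 'm set \<Rightarrow> ('m \<Rightarrow> 'a) \<Rightarrow> bool" where
  "matching_family C F S x \<longleftrightarrow>
    (\<forall>f\<in>S. x f \<in> sections F (src C f)) \<and>
    (\<forall>f\<in>S. \<forall>Z\<in>ob C. \<forall>g\<in>hom C Z (src C f). restr F g (x f) = x (f \<cdot>\<^bsub>C\<^esub> g))"

definition sheaf ::
    "('o, 'm) cat \<Rightarrow> ('o \<Rightarrow> 'm set set) \<Rightarrow> ('o, 'm, 'a) psh \<Rightarrow> bool" where
  "sheaf C J F \<longleftrightarrow> presheaf C F \<and>
    (\<forall>X\<in>ob C. \<forall>S\<in>J X. \<forall>x. matching_family C F S x \<longrightarrow>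
       (\<exists>!s. s \<in> sections F X \<and> (\<forall>f\<in>S. restr F f s = x f)))"

definition representable :: "('o, 'm) cat \<Rightarrow> 'o \<Rightarrow> ('o, 'm, 'm) psh" where
  "representable C W = \<lparr> sections = (\<lambda>X. hom C X W), restr = (\<lambda>f g. g \<cdot>\<^bsub>C\<^esub> f) \<rparr>"

definition subcanonical :: "('o, 'm) cat \<Rightarrow> ('o \<Rightarrow> 'm set set) \<Rightarrow> bool" where
  "subcanonical C J \<longleftrightarrow> (\<forall>W\<in>ob C. sheaf C J (representable C W))"

lemma (in category) generated_sieve_on:
  assumes "family_to C I f B"
  shows "sieve_on C B (generated_sieve C I f)"
  unfolding sieve_on_def generated_sieve_def
proof (intro conjI ballI subsetI)
  fix x assume "x \<in> {f i \<cdot> g | i g. i \<in> I \<and> g \<in> arr C \<and> tgt C g = src C (f i)}"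
  then show "x \<in> {f \<in> arr C. tgt C f = B}"
    using assms compose_hom unfolding family_to_def hom_def by blast
next
  fix x Z h
  assume x: "x \<in> {f i \<cdot> g | i g. i \<in> I \<and> g \<in> arr C \<and> tgt C g = src C (f i)}"
    and h: "h \<in> hom C Z (src C x)"
  from x obtain i g where ig: "x = f i \<cdot> g" "i \<in> I" "g \<in> arr C" "tgt C g = src C (f i)" by blast
  have fi: "f i \<in> hom C (src C (f i)) B" using assms ig unfolding family_to_def hom_def by auto
  have g: "g \<in> hom C (src C g) (src C (f i))" using ig unfolding hom_def by auto
  have "src C x = src C g" using compose_hom[OF g fi] ig(1) unfolding hom_def by auto
  then have h': "h \<in> hom C Z (src C g)" using h by simp
  have "x \<cdot> h = f i \<cdot> (g \<cdot> h)" using compose_assoc[OF h' g fi] ig by simp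
  then show "x \<cdot> h \<in> {f i \<cdot> g | i g. i \<in> I \<and> g \<in> arr C \<and> tgt C g = src C (f i)}"
    using ig(2) compose_hom[OF h' g] unfolding hom_def by auto
qed

lemma (in category) pullback_sieve_on:
  assumes S: "sieve_on C X S" and f: "f \<in> hom C Y X"
  shows "sieve_on C Y (pullback_sieve C f S)"
  unfolding sieve_on_def pullback_sieve_def
proof (intro conjI ballI subsetI)
  fix g assume "g \<in> {g \<in> arr C. tgt C g = src C f \<and> f \<cdot> g \<in> S}"
  then show "g \<in> {g \<in> arr C. tgt C g = Y}" using f unfolding hom_def by auto
next
  fix g Z h
  assume g: "g \<in> {g \<in> arr C. tgt C g = src C f \<and> f \<cdot> g \<in> S}"
    and Z: "Z \<in> ob C" and h: "h \<in> hom C Z (src C g)"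
  have g': "g \<in> hom C (src C g) Y" using g f unfolding hom_def by auto
  have "f \<cdot> g \<in> S" using g by simp
  moreover have "src C (f \<cdot> g) = src C g" using compose_hom[OF g' f] unfolding hom_def by auto
  ultimately have "(f \<cdot> g) \<cdot> h \<in> S" using S Z h unfolding sieve_on_def by auto
  then have "f \<cdot> (g \<cdot> h) \<in> S" using compose_assoc[OF h g' f] by simp
  then show "g \<cdot> h \<in> {g \<in> arr C. tgt C g = src C f \<and> f \<cdot> g \<in> S}"
    using compose_hom[OF h g'] f unfolding hom_def by auto
qed

lemma (in category) all_sieves_topology:
  "grothendieck_topology C (\<lambda>X. {S. sieve_on C X S})"
  unfolding grothendieck_topology_def
  using pullback_sieve_on compose_hom
  by (auto simp: maximal_sieve_def sieve_on_def[of C _ "{f \<in> arr C. tgt C f = _}"] hom_def)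

text \<open>The intersection of all topologies in question is again one of them, hence the smallest.\<close>

lemma (in category) coherent_topology_smallest:
  shows coherent_topology_grothendieck: "grothendieck_topology C (coherent_topology C)"
    and coherent_topology_contains: "contains_finite_effective_epis C (coherent_topology C)"
    and coherent_topology_least:
      "grothendieck_topology C J \<Longrightarrow> contains_finite_effective_epis C J \<Longrightarrow>
        coherent_topology C X \<subseteq> J X"
proof -
  let ?T = "\<lambda>J. grothendieck_topology C J \<and> contains_finite_effective_epis C J"
  have mem: "S \<in> coherent_topology C X \<longleftrightarrow> (\<forall>J. ?T J \<longrightarrow> S \<in> J X)" for S X
    unfolding coherent_topology_def by blast
  have all: "?T (\<lambda>X. {S. sieve_on C X S})"
    using all_sieves_topology generated_sieve_on
    unfolding contains_finite_effective_epis_def effective_epi_family_def by blast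
  show "contains_finite_effective_epis C (coherent_topology C)"
    unfolding contains_finite_effective_epis_def mem by blast
  show "grothendieck_topology C J \<Longrightarrow> contains_finite_effective_epis C J \<Longrightarrow>
        coherent_topology C X \<subseteq> J X"
    using mem by blast
  have 1: "sieve_on C X S" if "S \<in> coherent_topology C X" for X S
    using that all unfolding mem by blast
  have 2: "maximal_sieve C X \<in> coherent_topology C X" if "X \<in> ob C" for X
    using that unfolding mem grothendieck_topology_def by blast
  have 3: "pullback_sieve C f S \<in> coherent_topology C Y"
    if "X \<in> ob C" "S \<in> coherent_topology C X" "Y \<in> ob C" "f \<in> hom C Y X" for X S Y f
    using that unfolding mem grothendieck_topology_def by blast
  have 4: "R \<in> coherent_topology C X"
    if X: "X \<in> ob C" and S: "S \<in> coherent_topology C X" and R: "sieve_on C X R"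
      and loc: "\<And>f. f \<in> S \<Longrightarrow> pullback_sieve C f R \<in> coherent_topology C (src C f)" for X S R
    unfolding mem
  proof (intro allI impI)
    fix J assume J: "?T J"
    have "S \<in> J X" using S J mem by blast
    moreover have "\<forall>f\<in>S. pullback_sieve C f R \<in> J (src C f)" using loc J mem by blast
    ultimately show "R \<in> J X" using J X R unfolding grothendieck_topology_def by blast
  qed
  show "grothendieck_topology C (coherent_topology C)"
    unfolding grothendieck_topology_def using 1 2 3 4 by blast
qed

end

theory Submission imports Defs begin

text \<open>
  For a fixed presheaf \<open>F\<close>, the sieves whose pullbacks along all arrows satisfy the sheaf condition
  for \<open>F\<close> form a Grothendieck topology (\<open>sheaf_topology_grothendieck\<close>); it is the finest one for
  which \<open>F\<close> is a sheaf.  As the coherent topology is the smallest topology in which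
  finite effective epimorphic families cover, it suffices to see that for \<open>F = Hom(-,W)\<close> the sieve
  generated by such a family lies in this finest topology.

  By precoherence, the pullback of such a sieve along any arrow contains a finite effective
  epimorphic family again.  So what remains is that \<open>Hom(-,W)\<close> satisfies the sheaf condition for
  every sieve \<open>T\<close> that contains a finite effective epimorphic family \<open>p\<close>
  (\<open>representable_sheaf_condition\<close>).  A matching family on \<open>T\<close> restricts to compatible arrows on the
  \<open>p i\<close>, and effective epimorphy glues these to a unique \<open>d\<close>.  That \<open>d\<close> also restricts correctly
  along any other \<open>r \<in> T\<close> need not follow from \<open>p\<close> alone; but precoherence covers the source of \<open>r\<close>
  by a finite effective epimorphic family over which \<open>r\<close> factors through \<open>p\<close>, where the two
  candidates agree, and such a family is jointly epimorphic.
\<close>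

section \<open>The sheaf condition for a single sieve\<close>

definition sheaf_condition ::
    "('o, 'm) cat \<Rightarrow> ('o, 'm, 'a) psh \<Rightarrow> 'o \<Rightarrow> 'm set \<Rightarrow> bool" where
  "sheaf_condition C F X S \<longleftrightarrow> (\<forall>x. matching_family C F S x \<longrightarrow>
     (\<exists>!s. s \<in> sections F X \<and> (\<forall>f\<in>S. restr F f s = x f)))"

text \<open>The sheaf condition is demanded of every pullback because it is not stable under pullback by
  itself, whereas covering sieves have to be.\<close>

definition sheaf_topology ::
    "('o, 'm) cat \<Rightarrow> ('o, 'm, 'a) psh \<Rightarrow> 'o \<Rightarrow> 'm set set" where
  "sheaf_topology C F X = {S. sieve_on C X S \<and>
     (\<forall>Y\<in>ob C. \<forall>f\<in>hom C Y X. sheaf_condition C F Y (pullback_sieve C f S))}"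

lemma hom_src: "f \<in> hom C X Y \<Longrightarrow> src C f = X"
  and hom_tgt: "f \<in> hom C X Y \<Longrightarrow> tgt C f = Y"
  and hom_arr: "f \<in> hom C X Y \<Longrightarrow> f \<in> arr C"
  by (simp_all add: hom_def)

lemma arr_homI: "f \<in> arr C \<Longrightarrow> tgt C f = Y \<Longrightarrow> f \<in> hom C (src C f) Y"
  by (simp add: hom_def)

lemma sieve_on_hom: "sieve_on C X S \<Longrightarrow> f \<in> S \<Longrightarrow> f \<in> hom C (src C f) X"
  by (auto simp: sieve_on_def hom_def)

lemma presheaf_restr:
  "presheaf C F \<Longrightarrow> category C \<Longrightarrow> f \<in> hom C X Y \<Longrightarrow> s \<in> sections F Y
    \<Longrightarrow> restr F f s \<in> sections F X"
  unfolding presheaf_def using category.src_ob category.tgt_ob hom_src hom_tgt hom_arr by metis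

lemma presheaf_id:
  "presheaf C F \<Longrightarrow> X \<in> ob C \<Longrightarrow> s \<in> sections F X \<Longrightarrow> restr F (idm C X) s = s"
  unfolding presheaf_def by blast

lemma presheaf_compose:
  "presheaf C F \<Longrightarrow> category C \<Longrightarrow> f \<in> hom C X Y \<Longrightarrow> g \<in> hom C Y Z \<Longrightarrow> s \<in> sections F Z
    \<Longrightarrow> restr F (g \<cdot>\<^bsub>C\<^esub> f) s = restr F f (restr F g s)"
  unfolding presheaf_def using category.src_ob category.tgt_ob hom_src hom_tgt hom_arr by metis

context category
begin

lemma category_C: "category C"
  by (rule category_axioms)

lemma hom_src_ob: "f \<in> hom C X Y \<Longrightarrow> X \<in> ob C"
  using src_ob hom_src hom_arr by metis

lemma hom_tgt_ob: "f \<in> hom C X Y \<Longrightarrow> Y \<in> ob C"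
  using tgt_ob hom_tgt hom_arr by metis

lemma sieve_on_compose:
  "sieve_on C X S \<Longrightarrow> f \<in> S \<Longrightarrow> g \<in> hom C Z (src C f) \<Longrightarrow> f \<cdot> g \<in> S"
  unfolding sieve_on_def using hom_src_ob by blast

lemma pullback_sieve_iff:
  "f \<in> hom C Y X \<Longrightarrow> g \<in> pullback_sieve C f S \<longleftrightarrow> g \<in> hom C (src C g) Y \<and> f \<cdot> g \<in> S"
  by (auto simp: pullback_sieve_def hom_def)

lemma pullback_sieve_compose:
  assumes f: "f \<in> hom C Y X" and g: "g \<in> hom C Z Y"
  shows "pullback_sieve C g (pullback_sieve C f S) = pullback_sieve C (f \<cdot> g) S"
proof (rule set_eqI)
  fix h
  have fg: "f \<cdot> g \<in> hom C Z X" using compose_hom[OF g f] .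
  have "g \<cdot> h \<in> pullback_sieve C f S \<longleftrightarrow> (f \<cdot> g) \<cdot> h \<in> S" if h: "h \<in> hom C (src C h) Z"
    using compose_hom[OF h g] compose_assoc[OF h g f] hom_src
    by (metis pullback_sieve_iff[OF f])
  then show "h \<in> pullback_sieve C g (pullback_sieve C f S) \<longleftrightarrow> h \<in> pullback_sieve C (f \<cdot> g) S"
    using pullback_sieve_iff[OF g] pullback_sieve_iff[OF fg] by blast
qed

lemma pullback_sieve_idm:
  assumes X: "X \<in> ob C" and S: "sieve_on C X S"
  shows "pullback_sieve C (idm C X) S = S"
  using pullback_sieve_iff[OF idm_hom[OF X]] compose_idm_left sieve_on_hom[OF S]
  by (metis subsetI subset_antisym)

lemma pullback_sieve_member:
  assumes S: "sieve_on C X S" and f: "f \<in> S"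
  shows "pullback_sieve C f S = maximal_sieve C (src C f)"
  using pullback_sieve_iff[OF sieve_on_hom[OF S f]] sieve_on_compose[OF S f]
  by (auto simp: maximal_sieve_def hom_def)

lemma pullback_maximal_sieve:
  assumes f: "f \<in> hom C Y X"
  shows "pullback_sieve C f (maximal_sieve C X) = maximal_sieve C Y"
  using pullback_sieve_iff[OF f] compose_hom[OF _ f] by (auto simp: maximal_sieve_def hom_def)

lemma maximal_sieve_on: "sieve_on C X (maximal_sieve C X)"
  unfolding sieve_on_def maximal_sieve_def using compose_hom by (auto simp: hom_def)

lemma matching_family_compose:
  "matching_family C F S x \<Longrightarrow> f \<in> S \<Longrightarrow> g \<in> hom C Z (src C f)
    \<Longrightarrow> restr F g (x f) = x (f \<cdot> g)"
  unfolding matching_family_def using hom_src_ob by blast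

lemma matching_family_pullback:
  assumes R: "sieve_on C X R" and f: "f \<in> hom C Y X" and x: "matching_family C F R x"
  shows "matching_family C F (pullback_sieve C f R) (\<lambda>g. x (f \<cdot> g))"
  unfolding matching_family_def
proof (intro conjI ballI)
  fix g assume "g \<in> pullback_sieve C f R"
  then have g: "g \<in> hom C (src C g) Y" and fgR: "f \<cdot> g \<in> R"
    using pullback_sieve_iff[OF f] by blast+
  have src: "src C (f \<cdot> g) = src C g" using hom_src[OF compose_hom[OF g f]] .
  show "x (f \<cdot> g) \<in> sections F (src C g)"
    using x fgR src unfolding matching_family_def by metis
  fix Z h assume h: "h \<in> hom C Z (src C g)"
  show "restr F h (x (f \<cdot> g)) = x (f \<cdot> (g \<cdot> h))"
    using matching_family_compose[OF x fgR] h src compose_assoc[OF h g f] by metis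
qed

text \<open>A section of \<open>F\<close> restricts to a matching family on any sieve, so the uniqueness half of the
  sheaf condition applies to it.\<close>

lemma sheaf_condition_separated:
  assumes F: "presheaf C F" and S: "sieve_on C X S" and sh: "sheaf_condition C F X S"
    and s: "s \<in> sections F X" and t: "t \<in> sections F X"
    and eq: "\<And>f. f \<in> S \<Longrightarrow> restr F f s = restr F f t"
  shows "s = t"
proof -
  have "matching_family C F S (\<lambda>f. restr F f s)"
    unfolding matching_family_def
    using presheaf_restr[OF F category_C sieve_on_hom[OF S] s]
      presheaf_compose[OF F category_C _ sieve_on_hom[OF S] s] by auto
  with sh have "\<exists>!u. u \<in> sections F X \<and> (\<forall>f\<in>S. restr F f u = restr F f s)"
    unfolding sheaf_condition_def by blast
  then show ?thesis using s t eq by metis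
qed

lemma sheaf_condition_maximal:
  assumes F: "presheaf C F" and X: "X \<in> ob C"
  shows "sheaf_condition C F X (maximal_sieve C X)"
  unfolding sheaf_condition_def
proof (intro allI impI ex1I)
  fix x assume x: "matching_family C F (maximal_sieve C X) x"
  have i: "idm C X \<in> hom C X X" and iS: "idm C X \<in> maximal_sieve C X"
    using idm_hom[OF X] by (auto simp: maximal_sieve_def hom_def)
  have "restr F f (x (idm C X)) = x f" if "f \<in> maximal_sieve C X" for f
  proof -
    have f: "f \<in> hom C (src C f) X" using sieve_on_hom[OF maximal_sieve_on that] .
    show ?thesis using matching_family_compose[OF x iS] f compose_idm_left[OF f] hom_src[OF i] by metis
  qed
  then show "x (idm C X) \<in> sections F X \<and> (\<forall>f\<in>maximal_sieve C X. restr F f (x (idm C X)) = x f)"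
    using x iS hom_src[OF i] unfolding matching_family_def by metis
  fix s assume "s \<in> sections F X \<and> (\<forall>f\<in>maximal_sieve C X. restr F f s = x f)"
  then show "s = x (idm C X)" using iS presheaf_id[OF F X] by metis
qed

section \<open>The finest topology for which a presheaf is a sheaf\<close>

text \<open>The sheaf condition is local.  A matching family on \<open>R\<close> is glued in two stages: over each
  \<open>f \<in> S\<close> it glues on the pullback of \<open>R\<close> along \<open>f\<close> to a section \<open>y f\<close>, and these sections match
  on \<open>S\<close>.  Pullbacks of \<open>S\<close> enter because the resulting section has to be compared with the given
  family along arrows of \<open>R\<close> that are not in \<open>S\<close>.\<close>

lemma sheaf_condition_local:
  assumes F: "presheaf C F" and X: "X \<in> ob C"
    and R: "sieve_on C X R" and S: "S \<in> sheaf_topology C F X"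
    and loc: "\<And>f. f \<in> S \<Longrightarrow> sheaf_condition C F (src C f) (pullback_sieve C f R)"
  shows "sheaf_condition C F X R"
proof -
  have Ssv: "sieve_on C X S" using S unfolding sheaf_topology_def by blast
  have Spb: "sheaf_condition C F Y (pullback_sieve C f S)" if "f \<in> hom C Y X" for Y f
    using S that hom_src_ob[OF that] unfolding sheaf_topology_def by blast
  have Ssh: "sheaf_condition C F X S"
    using Spb[OF idm_hom[OF X]] pullback_sieve_idm[OF X Ssv] by simp
  note Sh = sieve_on_hom[OF Ssv]
  note Rpb = pullback_sieve_on[OF R Sh]
  show ?thesis
    unfolding sheaf_condition_def
  proof (intro allI impI)
    fix x assume x: "matching_family C F R x"
    have "\<exists>t. t \<in> sections F (src C f) \<and> (\<forall>g\<in>pullback_sieve C f R. restr F g t = x (f \<cdot> g))"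
      if "f \<in> S" for f
      using loc[OF that] matching_family_pullback[OF R Sh[OF that] x]
      unfolding sheaf_condition_def by blast
    then obtain y where y: "\<And>f. f \<in> S \<Longrightarrow> y f \<in> sections F (src C f)"
      and yx: "\<And>f g. f \<in> S \<Longrightarrow> g \<in> pullback_sieve C f R \<Longrightarrow> restr F g (y f) = x (f \<cdot> g)"
      by metis
    have ym: "restr F k (y f) = y (f \<cdot> k)" if f: "f \<in> S" and k: "k \<in> hom C Z (src C f)" for f k Z
    proof -
      have fk: "f \<cdot> k \<in> S" using sieve_on_compose[OF Ssv f k] .
      have src: "src C (f \<cdot> k) = Z" using hom_src[OF compose_hom[OF k Sh[OF f]]] .
      have fkh: "f \<cdot> k \<in> hom C Z X" using Sh[OF fk] src by simp
      show ?thesis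
      proof (rule sheaf_condition_separated[OF F Rpb[OF fk] loc[OF fk]])
        show "restr F k (y f) \<in> sections F (src C (f \<cdot> k))"
          using presheaf_restr[OF F category_C k y[OF f]] src by simp
        show "y (f \<cdot> k) \<in> sections F (src C (f \<cdot> k))" using y[OF fk] .
        fix m assume m: "m \<in> pullback_sieve C (f \<cdot> k) R"
        then have mh: "m \<in> hom C (src C m) Z" using pullback_sieve_iff[OF fkh] by blast
        have "m \<in> pullback_sieve C k (pullback_sieve C f R)"
          using m pullback_sieve_compose[OF Sh[OF f] k] by simp
        then have km: "k \<cdot> m \<in> pullback_sieve C f R" using pullback_sieve_iff[OF k] by blast
        have "restr F m (restr F k (y f)) = restr F (k \<cdot> m) (y f)"
          using presheaf_compose[OF F category_C mh k y[OF f]] by simp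
        also have "\<dots> = x (f \<cdot> (k \<cdot> m))" using yx[OF f km] .
        also have "\<dots> = x ((f \<cdot> k) \<cdot> m)" using compose_assoc[OF mh k Sh[OF f]] by simp
        also have "\<dots> = restr F m (y (f \<cdot> k))" using yx[OF fk m] by simp
        finally show "restr F m (restr F k (y f)) = restr F m (y (f \<cdot> k))" .
      qed
    qed
    have "matching_family C F S y" unfolding matching_family_def using y ym by blast
    then obtain s where s: "s \<in> sections F X" and sy: "\<And>f. f \<in> S \<Longrightarrow> restr F f s = y f"
      using Ssh unfolding sheaf_condition_def by blast
    \<comment> \<open>For an arrow in both sieves the first stage is trivial, its pullback of \<open>R\<close> being maximal.\<close>
    have yR: "y f = x f" if f: "f \<in> S" and fR: "f \<in> R" for f
    proof -
      have i: "idm C (src C f) \<in> hom C (src C f) (src C f)"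
        using idm_hom[OF hom_src_ob[OF Sh[OF f]]] .
      have "idm C (src C f) \<in> pullback_sieve C f R"
        using i unfolding pullback_sieve_member[OF R fR] maximal_sieve_def hom_def by simp
      then have "restr F (idm C (src C f)) (y f) = x (f \<cdot> idm C (src C f))" using yx[OF f] by simp
      then show ?thesis
        using presheaf_id[OF F hom_src_ob[OF Sh[OF f]] y[OF f]] compose_idm_right[OF Sh[OF f]] by simp
    qed
    have sx: "restr F r s = x r" if r: "r \<in> R" for r
    proof (rule sheaf_condition_separated[OF F pullback_sieve_on[OF Ssv] Spb])
      show rh: "r \<in> hom C (src C r) X" "r \<in> hom C (src C r) X" using sieve_on_hom[OF R r] by auto
      show "restr F r s \<in> sections F (src C r)" using presheaf_restr[OF F category_C rh(1) s] .
      show "x r \<in> sections F (src C r)" using x r unfolding matching_family_def by blast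
      fix k assume "k \<in> pullback_sieve C r S"
      then have k: "k \<in> hom C (src C k) (src C r)" and rk: "r \<cdot> k \<in> S"
        using pullback_sieve_iff[OF rh(1)] by blast+
      have "restr F k (restr F r s) = y (r \<cdot> k)"
        using presheaf_compose[OF F category_C k rh(1) s] sy[OF rk] by simp
      also have "\<dots> = restr F k (x r)"
        using yR[OF rk sieve_on_compose[OF R r k]] matching_family_compose[OF x r k] by simp
      finally show "restr F k (restr F r s) = restr F k (x r)" .
    qed
    show "\<exists>!s. s \<in> sections F X \<and> (\<forall>f\<in>R. restr F f s = x f)"
    proof (rule ex1I)
      show "s \<in> sections F X \<and> (\<forall>f\<in>R. restr F f s = x f)" using s sx by blast
      fix t assume "t \<in> sections F X \<and> (\<forall>f\<in>R. restr F f t = x f)"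
      then have t: "t \<in> sections F X" and tx: "\<And>f. f \<in> R \<Longrightarrow> restr F f t = x f" by blast+
      show "t = s"
      proof (rule sheaf_condition_separated[OF F Ssv Ssh t s])
        fix f assume f: "f \<in> S"
        note fh = Sh[OF f]
        show "restr F f t = restr F f s"
        proof (rule sheaf_condition_separated[OF F Rpb[OF f] loc[OF f]])
          show "restr F f t \<in> sections F (src C f)" "restr F f s \<in> sections F (src C f)"
            using presheaf_restr[OF F category_C fh] s t by blast+
          fix g assume "g \<in> pullback_sieve C f R"
          then have g: "g \<in> hom C (src C g) (src C f)" and fg: "f \<cdot> g \<in> R"
            using pullback_sieve_iff[OF fh] by blast+
          show "restr F g (restr F f t) = restr F g (restr F f s)"
            using presheaf_compose[OF F category_C g fh] s t sx[OF fg] tx[OF fg] by metis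
        qed
      qed
    qed
  qed
qed

lemma sheaf_topology_pullback:
  assumes f: "f \<in> hom C Y X" and S: "S \<in> sheaf_topology C F X"
  shows "pullback_sieve C f S \<in> sheaf_topology C F Y"
  using S pullback_sieve_on[OF _ f] compose_hom[OF _ f] pullback_sieve_compose[OF f]
  unfolding sheaf_topology_def by auto

lemma sheaf_topology_sheaf_condition:
  assumes X: "X \<in> ob C" and S: "S \<in> sheaf_topology C F X"
  shows "sheaf_condition C F X S"
  using S X idm_hom[OF X] pullback_sieve_idm[OF X] unfolding sheaf_topology_def
  by (metis (no_types, lifting) mem_Collect_eq)

lemma sheaf_topology_transitive:
  assumes F: "presheaf C F" and S: "S \<in> sheaf_topology C F X" and R: "sieve_on C X R"
    and loc: "\<And>f. f \<in> S \<Longrightarrow> pullback_sieve C f R \<in> sheaf_topology C F (src C f)"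
  shows "R \<in> sheaf_topology C F X"
proof -
  have "sheaf_condition C F Y (pullback_sieve C h R)" if Y: "Y \<in> ob C" and h: "h \<in> hom C Y X" for Y h
  proof (rule sheaf_condition_local[OF F Y pullback_sieve_on[OF R h] sheaf_topology_pullback[OF h S]])
    fix g assume "g \<in> pullback_sieve C h S"
    then have g: "g \<in> hom C (src C g) Y" and hg: "h \<cdot> g \<in> S" using pullback_sieve_iff[OF h] by blast+
    have "pullback_sieve C (h \<cdot> g) R \<in> sheaf_topology C F (src C g)"
      using loc[OF hg] hom_src[OF compose_hom[OF g h]] by simp
    then show "sheaf_condition C F (src C g) (pullback_sieve C g (pullback_sieve C h R))"
      using sheaf_topology_sheaf_condition[OF hom_src_ob[OF g]] pullback_sieve_compose[OF h g] by simp
  qed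
  then show ?thesis using R unfolding sheaf_topology_def by blast
qed

lemma sheaf_topology_grothendieck:
  assumes F: "presheaf C F"
  shows "grothendieck_topology C (sheaf_topology C F)"
  unfolding grothendieck_topology_def
proof (intro conjI ballI allI impI)
  fix X assume X: "X \<in> ob C"
  show "maximal_sieve C X \<in> sheaf_topology C F X"
    using maximal_sieve_on sheaf_condition_maximal[OF F] pullback_maximal_sieve
    unfolding sheaf_topology_def by auto
  fix S assume S: "S \<in> sheaf_topology C F X"
  show "sieve_on C X S" using S unfolding sheaf_topology_def by blast
  show "pullback_sieve C f S \<in> sheaf_topology C F Y" if "f \<in> hom C Y X" for Y f
    using sheaf_topology_pullback[OF that S] .
  fix R assume "sieve_on C X R \<and> (\<forall>f\<in>S. pullback_sieve C f R \<in> sheaf_topology C F (src C f))"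
  then show "R \<in> sheaf_topology C F X" using sheaf_topology_transitive[OF F S] by blast
qed

section \<open>Representable presheaves and effective epimorphic families\<close>

lemma representable_presheaf: "presheaf C (representable C W)"
  unfolding presheaf_def representable_def
  using compose_hom compose_idm_right compose_assoc by auto

lemma effective_epi_family_hom:
  "effective_epi_family C I p B \<Longrightarrow> i \<in> I \<Longrightarrow> p i \<in> hom C (src C (p i)) B"
  unfolding effective_epi_family_def family_to_def hom_def by blast

lemma effective_epi_family_glue:
  assumes p: "effective_epi_family C I p B" and W: "W \<in> ob C"
    and e: "\<And>i. i \<in> I \<Longrightarrow> e i \<in> hom C (src C (p i)) W"
    and comp: "\<And>i j Z g h. i \<in> I \<Longrightarrow> j \<in> I \<Longrightarrow> g \<in> hom C Z (src C (p i)) \<Longrightarrow>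
      h \<in> hom C Z (src C (p j)) \<Longrightarrow> p i \<cdot> g = p j \<cdot> h \<Longrightarrow> e i \<cdot> g = e j \<cdot> h"
  shows "\<exists>!d. d \<in> hom C B W \<and> (\<forall>i\<in>I. d \<cdot> p i = e i)"
proof -
  have "(\<forall>i\<in>I. e i \<in> hom C (src C (p i)) W) \<and>
      (\<forall>i\<in>I. \<forall>j\<in>I. \<forall>Z\<in>ob C. \<forall>g\<in>hom C Z (src C (p i)). \<forall>h\<in>hom C Z (src C (p j)).
         p i \<cdot> g = p j \<cdot> h \<longrightarrow> e i \<cdot> g = e j \<cdot> h)"
    using e comp by blast
  then show ?thesis using p W unfolding effective_epi_family_def by blast
qed

text \<open>The arrows \<open>d \<cdot> p i\<close> are compatible, so \<open>d\<close> is the only arrow that glues them.\<close>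

lemma effective_epi_family_jointly_epi:
  assumes p: "effective_epi_family C I p B" and d: "d \<in> hom C B W" and d': "d' \<in> hom C B W"
    and eq: "\<And>i. i \<in> I \<Longrightarrow> d \<cdot> p i = d' \<cdot> p i"
  shows "d = d'"
proof -
  note ph = effective_epi_family_hom[OF p]
  have "\<exists>!u. u \<in> hom C B W \<and> (\<forall>i\<in>I. u \<cdot> p i = d \<cdot> p i)"
  proof (rule effective_epi_family_glue[OF p hom_tgt_ob[OF d]])
    show "d \<cdot> p i \<in> hom C (src C (p i)) W" if "i \<in> I" for i
      using compose_hom[OF ph[OF that] d] .
    show "(d \<cdot> p i) \<cdot> g = (d \<cdot> p j) \<cdot> h"
      if "i \<in> I" "j \<in> I" "g \<in> hom C Z (src C (p i))" "h \<in> hom C Z (src C (p j))"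
        "p i \<cdot> g = p j \<cdot> h" for i j Z g h
      using compose_assoc[OF that(3) ph[OF that(1)] d] compose_assoc[OF that(4) ph[OF that(2)] d]
        that(5) by simp
  qed
  then show ?thesis using d d' eq by metis
qed

end

context precoherent_category
begin

text \<open>\<open>T\<close> may be larger than the sieve generated by \<open>p\<close>: a pullback of a generated sieve is known
  only to contain an effective epimorphic family, not to be generated by one.\<close>

lemma representable_sheaf_condition:
  fixes I :: "nat set"
  assumes I: "finite I" and p: "effective_epi_family C I p X" and T: "sieve_on C X T"
    and pT: "\<And>i. i \<in> I \<Longrightarrow> p i \<in> T" and W: "W \<in> ob C"
  shows "sheaf_condition C (representable C W) X T"
  unfolding sheaf_condition_def
proof (intro allI impI)
  fix x assume x: "matching_family C (representable C W) T x"
  note ph = effective_epi_family_hom[OF p]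
  have xh: "x f \<in> hom C (src C f) W" if "f \<in> T" for f
    using x that unfolding matching_family_def representable_def by simp
  have xc: "x f \<cdot> g = x (f \<cdot> g)" if "f \<in> T" "g \<in> hom C Z (src C f)" for f g Z
    using matching_family_compose[OF x that] unfolding representable_def by simp
  have "\<exists>!d. d \<in> hom C X W \<and> (\<forall>i\<in>I. d \<cdot> p i = x (p i))"
  proof (rule effective_epi_family_glue[OF p W])
    show "x (p i) \<in> hom C (src C (p i)) W" if "i \<in> I" for i
      using xh[OF pT[OF that]] .
    show "x (p i) \<cdot> g = x (p j) \<cdot> h"
      if "i \<in> I" "j \<in> I" "g \<in> hom C Z (src C (p i))" "h \<in> hom C Z (src C (p j))"
        "p i \<cdot> g = p j \<cdot> h" for i j Z g h
      using xc[OF pT[OF that(1)] that(3)] xc[OF pT[OF that(2)] that(4)] that(5) by simp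
  qed
  then obtain d where d: "d \<in> hom C X W" and dp: "\<And>i. i \<in> I \<Longrightarrow> d \<cdot> p i = x (p i)" by blast
  \<comment> \<open>Compare after precomposing with a family over which \<open>r\<close> factors through \<open>p\<close>.\<close>
  have dx: "d \<cdot> r = x r" if r: "r \<in> T" for r
  proof -
    have rh: "r \<in> hom C (src C r) X" using sieve_on_hom[OF T r] .
    obtain J :: "nat set" and q where q: "effective_epi_family C J q (src C r)"
      and fac: "\<forall>j\<in>J. \<exists>i\<in>I. \<exists>h\<in>hom C (src C (q j)) (src C (p i)). r \<cdot> q j = p i \<cdot> h"
      using precoherent[OF I p rh] by blast
    show ?thesis
    proof (rule effective_epi_family_jointly_epi[OF q compose_hom[OF rh d] xh[OF r]])
      fix j assume j: "j \<in> J"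
      obtain i h where i: "i \<in> I" and h: "h \<in> hom C (src C (q j)) (src C (p i))"
        and rq: "r \<cdot> q j = p i \<cdot> h"
        using fac j by blast
      note qh = effective_epi_family_hom[OF q j]
      have "(d \<cdot> r) \<cdot> q j = d \<cdot> (p i \<cdot> h)" using compose_assoc[OF qh rh d] rq by simp
      also have "\<dots> = x (p i) \<cdot> h" using compose_assoc[OF h ph[OF i] d] dp[OF i] by simp
      also have "\<dots> = x (r \<cdot> q j)" using xc[OF pT[OF i] h] rq by simp
      also have "\<dots> = x r \<cdot> q j" using xc[OF r qh] by simp
      finally show "(d \<cdot> r) \<cdot> q j = x r \<cdot> q j" .
    qed
  qed
  show "\<exists>!s. s \<in> sections (representable C W) X \<and> (\<forall>f\<in>T. restr (representable C W) f s = x f)"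
    unfolding representable_def
    using d dx effective_epi_family_jointly_epi[OF p _ d] pT by (auto intro!: ex1I[of _ d])
qed

lemma generated_sieve_in_sheaf_topology:
  fixes I :: "nat set"
  assumes I: "finite I" and p: "effective_epi_family C I p B" and W: "W \<in> ob C"
  shows "generated_sieve C I p \<in> sheaf_topology C (representable C W) B"
proof -
  have S: "sieve_on C B (generated_sieve C I p)"
    using generated_sieve_on p unfolding effective_epi_family_def by blast
  have "sheaf_condition C (representable C W) Y (pullback_sieve C f (generated_sieve C I p))"
    if f: "f \<in> hom C Y B" for Y f
  proof -
    obtain J :: "nat set" and q where J: "finite J" and q: "effective_epi_family C J q Y"
      and fac: "\<forall>j\<in>J. \<exists>i\<in>I. \<exists>h\<in>hom C (src C (q j)) (src C (p i)). f \<cdot> q j = p i \<cdot> h"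
      using precoherent[OF I p f] by blast
    show ?thesis
    proof (rule representable_sheaf_condition[OF J q pullback_sieve_on[OF S f] _ W])
      fix j assume j: "j \<in> J"
      have "f \<cdot> q j \<in> generated_sieve C I p"
        using fac j unfolding generated_sieve_def hom_def by blast
      then show "q j \<in> pullback_sieve C f (generated_sieve C I p)"
        using pullback_sieve_iff[OF f] effective_epi_family_hom[OF q j] by blast
    qed
  qed
  then show ?thesis using S unfolding sheaf_topology_def by blast
qed

end

theorem proposition6p8:
  fixes C :: "('o, 'm) cat"
  assumes "precoherent_category C"
  shows "subcanonical C (coherent_topology C)"
proof -
  interpret precoherent_category C by (rule assms)
  have "sheaf C (coherent_topology C) (representable C W)" if W: "W \<in> ob C" for W
  proof -
    let ?F = "representable C W"
    have "contains_finite_effective_epis C (sheaf_topology C ?F)"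
      unfolding contains_finite_effective_epis_def
      using generated_sieve_in_sheaf_topology[OF _ _ W] by blast
    then have "coherent_topology C X \<subseteq> sheaf_topology C ?F X" for X
      using coherent_topology_least[OF sheaf_topology_grothendieck[OF representable_presheaf]] by blast
    then have "sheaf_condition C ?F X S" if "X \<in> ob C" "S \<in> coherent_topology C X" for X S
      using that sheaf_topology_sheaf_condition by blast
    then show ?thesis
      using representable_presheaf unfolding sheaf_def sheaf_condition_def by blast
  qed
  then show ?thesis unfolding subcanonical_def by blast
qed

end
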